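(* For $q$ ranging over odd primes, as $q\to\infty$, with absolute implied constants: 1) $\left|{}_4F_3(1)-\frac{1}{q^3}\right|\le\frac1q+O\left(\frac{1}{q^{3/2}}\right)$; 2) $\left|{}_6F_5(1)\right|=O\left(\frac{1}{q^2}\right)$.
   Context: For an odd prime $q$, $\mathbb{F}_q$ is the finite field with $q$ elements; $\epsilon$ and $\phi$ are the trivial and quadratic multiplicative characters of $\mathbb{F}_q$. Every multiplicative character $\chi$ (including $\epsilon$) is extended to $\mathbb{F}_q$ by $\chi(0)=0$; $\overline{\chi}$ is the inverse character. For multiplicative characters $A,B$: $J(A,B)=\sum_{x\in\mathbb{F}_q}A(x)B(1-x)$ and $\binom{A}{B}=\frac{B(-1)}{q}J(A,\overline{B})$. For $n\ge1$ and $x\in\mathbb{F}_q$, $${}_{n+1}F_n(x):={}_{n+1}F_n\left(\begin{matrix}\phi & \phi & \cdots & \phi\\ & \epsilon & \cdots & \epsilon\end{matrix}\ \middle|\ x\right)=\frac{q}{q-1}\sum_{\chi}\binom{\phi\chi}{\chi}^{n+1}\chi(x),$$ the sum running over all multiplicative characters $\chi$ of $\mathbb{F}_q$. The values ${}_4F_3(1)$ and ${}_6F_5(1)$ depend on $q$. *)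

theory Defs
  imports
    Complex_Main
    "HOL-Algebra.Multiplicative_Group"
    "HOL-Number_Theory.Residues"
    "HOL-Library.Landau_Symbols"
begin

definition complex_units :: "complex monoid" where
  "complex_units = \<lparr>carrier = - {0}, monoid.mult = (*), one = 1\<rparr>"

text \<open>
  Multiplicative characters are total functions vanishing at zero; they are also required
  to vanish outside the carrier, so that distinct elements of this set are distinct characters.
\<close>
definition mult_chars :: "('a, 'b) ring_scheme \<Rightarrow> ('a \<Rightarrow> complex) set" where
  "mult_chars R =
     {\<chi> \<in> hom (mult_of R) complex_units. \<forall>x. x \<notin> carrier (mult_of R) \<longrightarrow> \<chi> x = 0}"

definition quad_char :: "('a, 'b) ring_scheme \<Rightarrow> 'a \<Rightarrow> complex" where
  "quad_char R x =
     (if x \<notin> carrier (mult_of R) then 0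
      else if \<exists>y\<in>carrier R. x = y \<otimes>\<^bsub>R\<^esub> y then 1 else - 1)"

definition jacobi_sum ::
  "('a, 'b) ring_scheme \<Rightarrow> ('a \<Rightarrow> complex) \<Rightarrow> ('a \<Rightarrow> complex) \<Rightarrow> complex" where
  "jacobi_sum R A B = (\<Sum>x\<in>carrier R. A x * B (\<one>\<^bsub>R\<^esub> \<ominus>\<^bsub>R\<^esub> x))"

text \<open>
  The inverse of the character \<open>B\<close> is its pointwise inverse, which still vanishes at zero
  because \<open>inverse 0 = 0\<close>.
\<close>
definition char_binom ::
  "('a, 'b) ring_scheme \<Rightarrow> ('a \<Rightarrow> complex) \<Rightarrow> ('a \<Rightarrow> complex) \<Rightarrow> complex" where
  "char_binom R A B =
     B (\<ominus>\<^bsub>R\<^esub> \<one>\<^bsub>R\<^esub>) / of_nat (order R) * jacobi_sum R A (\<lambda>x. inverse (B x))"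

text \<open>
  \<open>hyp_F R n x\<close> is the Gaussian hypergeometric value
  \<open>\<^sub>n\<^sub>+\<^sub>1F\<^sub>n(x)\<close> over the finite field \<open>R\<close>
  with all upper parameters quadratic and all lower parameters trivial.
\<close>
definition hyp_F :: "('a, 'b) ring_scheme \<Rightarrow> nat \<Rightarrow> 'a \<Rightarrow> complex" where
  "hyp_F R n x =
     of_nat (order R) / (of_nat (order R) - 1) *
       (\<Sum>\<chi>\<in>mult_chars R. char_binom R (\<lambda>y. quad_char R y * \<chi> y) \<chi> ^ (n + 1) * \<chi> x)"

definition odd_primes_at_top :: "nat filter" where
  "odd_primes_at_top = inf at_top (principal {q. prime q \<and> odd q})"

end

theory Submission imports Defs begin

text \<open>
  Every coefficient \<open>char_binom R (\<phi>\<chi>) \<chi>\<close> has modulus at most \<open>q\<^sup>-\<^sup>1\<^sup>/\<^sup>2\<close>, because one of the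
  two characters in its Jacobi sum is nontrivial, and then the modulus of the sum is at most
  \<open>\<surd>q\<close>. Since there are at most \<open>q - 1\<close> characters, the triangle inequality bounds the
  hypergeometric value with exponent \<open>n + 1\<close> by \<open>q\<^sup>(\<^sup>1\<^sup>-\<^sup>n\<^sup>)\<^sup>/\<^sup>2\<close>, which is \<open>1/q\<close> for \<open>n = 3\<close> and
  \<open>1/q\<^sup>2\<close> for \<open>n = 5\<close>.
\<close>

section \<open>Values of multiplicative characters\<close>

locale finite_field = field R for R (structure) +
  assumes finite_carrier: "finite (carrier R)"
begin

abbreviation "char_sum C \<equiv> \<Sum>x\<in>carrier R. C x"

lemma mult_charD:
  assumes "C \<in> mult_chars R"
  shows "C \<zero> = 0"
    and "x \<in> carrier R - {\<zero>} \<Longrightarrow> C x \<noteq> 0"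
    and "x \<in> carrier R - {\<zero>} \<Longrightarrow> y \<in> carrier R - {\<zero>} \<Longrightarrow> C (x \<otimes> y) = C x * C y"
  using assms unfolding mult_chars_def complex_units_def hom_def by auto

text \<open>Both sides vanish when an argument is zero, so multiplicativity extends from the unit
  group to the whole carrier and later changes of variable need no case split.\<close>

lemma mult_char_mult:
  assumes "C \<in> mult_chars R" "x \<in> carrier R" "y \<in> carrier R"
  shows "C (x \<otimes> y) = C x * C y"
  using assms mult_charD[OF assms(1)] by (cases "x = \<zero>"; cases "y = \<zero>") auto

lemma mult_char_one:
  assumes "C \<in> mult_chars R"
  shows "C \<one> = 1"
  using mult_char_mult[OF assms one_closed one_closed] mult_charD(2)[OF assms, of \<one>] by simp

lemma mult_char_pow:
  assumes "C \<in> mult_chars R" "x \<in> carrier R"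
  shows "C (x [^] (n::nat)) = C x ^ n"
  by (induction n) (use assms in \<open>auto simp: mult_char_one mult_char_mult\<close>)

lemma order_ge_2: "order R \<ge> 2"
proof -
  have "card {\<zero>, \<one>} \<le> card (carrier R)"
    by (rule card_mono) (auto simp: finite_carrier)
  then show ?thesis
    by (simp add: order_def)
qed

text \<open>Lagrange's theorem in the unit group, which has \<open>order R - 1\<close>
  elements.\<close>

lemma unit_pow_eq_one:
  assumes "x \<in> carrier R - {\<zero>}"
  shows "x [^] (order R - 1) = \<one>"
proof -
  interpret G: group "mult_of R" by (rule field_mult_group)
  have "x [^]\<^bsub>mult_of R\<^esub> order (mult_of R) = \<one>\<^bsub>mult_of R\<^esub>"
    using assms by (intro G.pow_order_eq_1) auto
  then show ?thesis
    using order_mult_of[OF finite_carrier] by (simp add: nat_pow_mult_of)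
qed

text \<open>The value is a root of unity: raising it to the power \<open>order R - 1\<close> gives
  \<open>C \<one> = 1\<close>.\<close>

lemma norm_mult_char:
  assumes "C \<in> mult_chars R" "x \<in> carrier R - {\<zero>}"
  shows "cmod (C x) = 1"
proof -
  have "C x ^ (order R - 1) = 1"
    using mult_char_pow[OF assms(1), of x "order R - 1"] unit_pow_eq_one[OF assms(2)]
      mult_char_one[OF assms(1)] assms(2) by simp
  then have "cmod (C x) ^ (order R - 1) = 1"
    by (metis norm_one norm_power)
  then show ?thesis
    using power_eq_imp_eq_base[of "cmod (C x)" "order R - 1" 1] order_ge_2 by simp
qed

lemma norm_mult_char_le:
  assumes "C \<in> mult_chars R" "x \<in> carrier R"
  shows "cmod (C x) \<le> 1"
  using norm_mult_char[OF assms(1), of x] mult_charD(1)[OF assms(1)] assms(2)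
  by (cases "x = \<zero>") auto

text \<open>On units this is modulus one; at zero both sides are 0 because
  \<open>inverse 0 = 0\<close>.\<close>

lemma cnj_mult_char:
  assumes "C \<in> mult_chars R" "x \<in> carrier R"
  shows "cnj (C x) = inverse (C x)"
proof (cases "x = \<zero>")
  case False
  then have "C x * cnj (C x) = 1"
    using complex_norm_square[of "C x"] norm_mult_char[OF assms(1), of x] assms(2) by simp
  then show ?thesis
    by (rule inverse_unique[symmetric])
qed (simp add: mult_charD(1)[OF assms(1)])

lemma mult_char_inv:
  assumes "C \<in> mult_chars R" "x \<in> carrier R - {\<zero>}"
  shows "C (inv x) = inverse (C x)"
proof -
  have "C (inv x) * C x = 1"
    using assms mult_char_mult[OF assms(1), of "inv x" x]
    by (simp add: field_Units mult_char_one)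
  then show ?thesis
    by (metis inverse_unique mult.commute)
qed

lemma mult_charI:
  assumes "\<And>x. x \<in> carrier R - {\<zero>} \<Longrightarrow> C x \<noteq> 0"
    and "\<And>x y. x \<in> carrier R - {\<zero>} \<Longrightarrow> y \<in> carrier R - {\<zero>} \<Longrightarrow> C (x \<otimes> y) = C x * C y"
    and "\<And>x. x \<notin> carrier R - {\<zero>} \<Longrightarrow> C x = 0"
  shows "C \<in> mult_chars R"
  using assms unfolding mult_chars_def complex_units_def hom_def by auto

lemma mult_chars_closed_mult:
  assumes "A \<in> mult_chars R" "B \<in> mult_chars R"
  shows "(\<lambda>x. A x * B x) \<in> mult_chars R"
  using assms unfolding mult_chars_def complex_units_def hom_def by auto

lemma mult_chars_closed_inverse:
  assumes "A \<in> mult_chars R"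
  shows "(\<lambda>x. inverse (A x)) \<in> mult_chars R"
  using assms unfolding mult_chars_def complex_units_def hom_def by auto

section \<open>Permutations by unit multiplication and sums of characters\<close>

lemma mult_unit_bij:
  assumes "a \<in> carrier R - {\<zero>}"
  shows "bij_betw (\<lambda>x. a \<otimes> x) (carrier R) (carrier R)"
proof -
  have "inj_on (\<lambda>x. a \<otimes> x) (carrier R)"
    using assms by (intro inj_onI) (auto simp: m_lcancel)
  moreover have "(\<lambda>x. a \<otimes> x) ` carrier R \<subseteq> carrier R"
    using assms by auto
  ultimately show ?thesis
    using endo_inj_surj[OF finite_carrier] by (auto simp: bij_betw_def)
qed

lemma mult_unit_bij_units:
  assumes "a \<in> carrier R - {\<zero>}"
  shows "bij_betw (\<lambda>x. x \<otimes> a) (carrier R - {\<zero>}) (carrier R - {\<zero>})"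
proof -
  have "inj_on (\<lambda>x. x \<otimes> a) (carrier R - {\<zero>})"
    using assms by (intro inj_onI) (auto simp: m_rcancel)
  moreover have "(\<lambda>x. x \<otimes> a) ` (carrier R - {\<zero>}) \<subseteq> carrier R - {\<zero>}"
    using assms by (auto simp: integral_iff)
  ultimately show ?thesis
    using endo_inj_surj[of "carrier R - {\<zero>}"] finite_carrier by (auto simp: bij_betw_def)
qed

text \<open>Orthogonality: if \<open>C a \<noteq> 1\<close> for some unit \<open>a\<close>, the
  substitution of \<open>a \<otimes> x\<close> for \<open>x\<close> permutes the field and
  multiplies the sum by \<open>C a\<close>, so the sum is 0.\<close>

lemma char_sum_cases:
  assumes "C \<in> mult_chars R"
  shows "char_sum C = 0 \<or> (\<forall>x\<in>carrier R - {\<zero>}. C x = 1)"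
proof (cases "\<forall>x\<in>carrier R - {\<zero>}. C x = 1")
  case False
  then obtain a where a: "a \<in> carrier R - {\<zero>}" "C a \<noteq> 1" by auto
  have "char_sum C = (\<Sum>x\<in>carrier R. C (a \<otimes> x))"
    by (rule sum.reindex_bij_betw[OF mult_unit_bij[OF a(1)], symmetric])
  also have "\<dots> = C a * char_sum C"
    using a by (simp add: sum_distrib_left mult_char_mult[OF assms])
  finally show ?thesis
    using a(2) by simp
qed auto

text \<open>The sum is either 0 or the number of units. This sign allows the subtracted terms in the
  formula for the squared modulus of a Jacobi sum to be dropped.\<close>

lemma char_sum_nonneg:
  assumes "C \<in> mult_chars R"
  shows "Re (char_sum C) \<ge> 0"
proof -
  have "Re (char_sum C) \<ge> 0" if "\<forall>x\<in>carrier R - {\<zero>}. C x = 1"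
  proof -
    have "Re (C x) \<ge> 0" if "x \<in> carrier R" for x
      using that \<open>\<forall>x\<in>_. _\<close> mult_charD(1)[OF assms] by (cases "x = \<zero>") auto
    then show ?thesis
      by (simp add: sum_nonneg)
  qed
  with char_sum_cases[OF assms] show ?thesis
    by (metis order_refl zero_complex.sel(1))
qed

section \<open>Jacobi sums and their modulus\<close>

lemma one_minus_bij: "bij_betw (\<lambda>x. \<one> \<ominus> x) (carrier R) (carrier R)"
proof (rule bij_betwI[where g = "\<lambda>x. \<one> \<ominus> x"])
  have "\<one> \<ominus> (\<one> \<ominus> x) = x" if "x \<in> carrier R" for x
    using that by algebra
  then show "\<one> \<ominus> (\<one> \<ominus> x) = x" "\<one> \<ominus> (\<one> \<ominus> x) = x" if "x \<in> carrier R" for x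
    using that by auto
qed auto

text \<open>Substitute \<open>\<one> \<ominus> x\<close> for \<open>x\<close>. The symmetry lets the
  nontrivial character always be taken as the second argument.\<close>

lemma jacobi_sum_commute: "jacobi_sum R A B = jacobi_sum R B A"
proof -
  have "jacobi_sum R A B = (\<Sum>x\<in>carrier R. A (\<one> \<ominus> x) * B (\<one> \<ominus> (\<one> \<ominus> x)))"
    unfolding jacobi_sum_def by (rule sum.reindex_bij_betw[OF one_minus_bij, symmetric])
  also have "\<dots> = (\<Sum>x\<in>carrier R. B x * A (\<one> \<ominus> x))"
  proof (rule sum.cong[OF refl])
    fix x assume "x \<in> carrier R"
    then have "\<one> \<ominus> (\<one> \<ominus> x) = x" by algebra
    then show "A (\<one> \<ominus> x) * B (\<one> \<ominus> (\<one> \<ominus> x)) = B x * A (\<one> \<ominus> x)" by simp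
  qed
  finally show ?thesis by (simp add: jacobi_sum_def)
qed

lemma minus_eq_zero_iff:
  assumes "x \<in> carrier R" "y \<in> carrier R"
  shows "x \<ominus> y = \<zero> \<longleftrightarrow> x = y"
  using assms r_right_minus_eq by auto

lemma inv_bij: "bij_betw (\<lambda>x. inv x) (carrier R - {\<zero>}) (carrier R - {\<zero>})"
  by (rule bij_betwI[where g = "\<lambda>x. inv x"])
     (use Units_inv_Units in \<open>auto simp: field_Units[symmetric]\<close>)

lemma affine_bij:
  assumes "a \<in> carrier R - {\<zero>}" "b \<in> carrier R"
  shows "bij_betw (\<lambda>x. b \<oplus> a \<otimes> x) (carrier R) (carrier R)"
proof -
  have "inj_on (\<lambda>x. b \<oplus> a \<otimes> x) (carrier R)"
    using assms by (intro inj_onI) (auto simp: m_lcancel)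
  moreover have "(\<lambda>x. b \<oplus> a \<otimes> x) ` carrier R \<subseteq> carrier R"
    using assms by auto
  ultimately show ?thesis
    using endo_inj_surj[OF finite_carrier] by (auto simp: bij_betw_def)
qed

text \<open>
  The correlation is a character sum over the values of the fractional linear map
  \<open>y \<mapsto> (1 - uy)/(1 - y) = u + (1 - u)/(1 - y)\<close>.
\<close>

lemma char_correlation:
  assumes B: "B \<in> mult_chars R" and B0: "char_sum B = 0" and u: "u \<in> carrier R"
  shows "(\<Sum>y\<in>carrier R. B (\<one> \<ominus> u \<otimes> y) * cnj (B (\<one> \<ominus> y)))
           = (if u = \<one> then of_nat (order R) else 0) - B u"
proof -
  let ?U = "carrier R - {\<zero>}"
  \<comment> \<open>Put \<open>y = \<one> \<ominus> z\<close>, so that the denominator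
    \<open>\<one> \<ominus> y\<close> of the fractional linear map becomes \<open>z\<close>; the
    term at \<open>z = \<zero>\<close> then vanishes.\<close>
  have "(\<Sum>y\<in>carrier R. B (\<one> \<ominus> u \<otimes> y) * cnj (B (\<one> \<ominus> y)))
      = (\<Sum>z\<in>carrier R. B (\<one> \<ominus> u \<otimes> (\<one> \<ominus> z)) * cnj (B (\<one> \<ominus> (\<one> \<ominus> z))))"
    by (rule sum.reindex_bij_betw[OF one_minus_bij, symmetric])
  also have "\<dots> = (\<Sum>z\<in>?U. B (\<one> \<ominus> u \<otimes> (\<one> \<ominus> z)) * cnj (B (\<one> \<ominus> (\<one> \<ominus> z))))"
  proof (rule sum.mono_neutral_right)
    have "\<one> \<ominus> (\<one> \<ominus> \<zero>) = \<zero>" by algebra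
    then have "B (\<one> \<ominus> (\<one> \<ominus> \<zero>)) = 0"
      by (simp only: mult_charD(1)[OF B])
    moreover have "i = \<zero>" if "i \<in> carrier R - ?U" for i
      using that by simp
    ultimately show "\<forall>i\<in>carrier R - ?U. B (\<one> \<ominus> u \<otimes> (\<one> \<ominus> i)) * cnj (B (\<one> \<ominus> (\<one> \<ominus> i))) = 0"
      by (metis complex_cnj_zero mult_zero_right)
  qed (auto simp: finite_carrier)
  also have "\<dots> = (\<Sum>z\<in>?U. B (u \<oplus> (\<one> \<ominus> u) \<otimes> inv z))"
  proof (rule sum.cong[OF refl])
    fix z assume z: "z \<in> ?U"
    then have zc: "z \<in> carrier R" and zi: "inv z \<in> carrier R" and ziz: "z \<otimes> inv z = \<one>"
      by (auto simp: field_Units)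
    have 1: "\<one> \<ominus> (\<one> \<ominus> z) = z" using zc by algebra
    have "\<one> \<ominus> u \<otimes> (\<one> \<ominus> z) = u \<otimes> z \<oplus> (\<one> \<ominus> u)"
      using zc u by algebra
    then have "(\<one> \<ominus> u \<otimes> (\<one> \<ominus> z)) \<otimes> inv z = (u \<otimes> z \<oplus> (\<one> \<ominus> u)) \<otimes> inv z"
      by simp
    also have "\<dots> = u \<otimes> (z \<otimes> inv z) \<oplus> (\<one> \<ominus> u) \<otimes> inv z"
      using zc zi u by algebra
    finally have 2: "(\<one> \<ominus> u \<otimes> (\<one> \<ominus> z)) \<otimes> inv z = u \<oplus> (\<one> \<ominus> u) \<otimes> inv z"
      using ziz u by simp
    have "B (\<one> \<ominus> u \<otimes> (\<one> \<ominus> z)) * cnj (B z) = B ((\<one> \<ominus> u \<otimes> (\<one> \<ominus> z)) \<otimes> inv z)"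
      using z zc zi u by (simp add: mult_char_mult[OF B] mult_char_inv[OF B] cnj_mult_char[OF B])
    then show "B (\<one> \<ominus> u \<otimes> (\<one> \<ominus> z)) * cnj (B (\<one> \<ominus> (\<one> \<ominus> z))) = B (u \<oplus> (\<one> \<ominus> u) \<otimes> inv z)"
      using 1 2 by simp
  qed
  also have "\<dots> = (\<Sum>v\<in>?U. B (u \<oplus> (\<one> \<ominus> u) \<otimes> v))"
    by (rule sum.reindex_bij_betw[OF inv_bij])
  \<comment> \<open>Completing the sum by \<open>v = \<zero>\<close> adds the term
    \<open>B u\<close>, which is the source of the correction in the result.\<close>
  also have "\<dots> = (\<Sum>v\<in>carrier R. B (u \<oplus> (\<one> \<ominus> u) \<otimes> v)) - B u"
    using u by (subst (2) sum.remove[of _ \<zero>]) (auto simp: finite_carrier)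
  \<comment> \<open>For \<open>u = \<one>\<close> every argument is \<open>\<one>\<close>. Otherwise
    the argument runs over the whole field and the sum is that of \<open>B\<close>, which is
    0.\<close>
  also have "(\<Sum>v\<in>carrier R. B (u \<oplus> (\<one> \<ominus> u) \<otimes> v)) = (if u = \<one> then of_nat (order R) else 0)"
  proof (cases "u = \<one>")
    case True
    then have "\<one> \<ominus> u = \<zero>" using u by (simp only: minus_eq_zero_iff)
    then have "u \<oplus> (\<one> \<ominus> u) \<otimes> v = \<one>" if "v \<in> carrier R" for v
      using True that by (simp only: l_null r_zero one_closed)
    then have "(\<Sum>v\<in>carrier R. B (u \<oplus> (\<one> \<ominus> u) \<otimes> v)) = (\<Sum>v\<in>carrier R. 1)"
      by (intro sum.cong refl) (simp only: mult_char_one[OF B])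
    then show ?thesis
      using True by (simp add: order_def)
  next
    case False
    then have "\<one> \<ominus> u \<in> ?U" using u by (simp add: minus_eq_zero_iff)
    from sum.reindex_bij_betw[OF affine_bij[OF this u], of B] False B0 show ?thesis by simp
  qed
  finally show ?thesis .
qed

text \<open>Expand the product as a double sum over units \<open>x\<close>, \<open>y\<close> and put
  \<open>x = u \<otimes> y\<close>. The values of \<open>A\<close> then combine to
  \<open>A u\<close>, and the inner sum over \<open>y\<close> is the correlation computed in
  \<open>char_correlation\<close>, up to its term at zero.\<close>

lemma jacobi_sum_mult_cnj:
  assumes A: "A \<in> mult_chars R" and B: "B \<in> mult_chars R" and B0: "char_sum B = 0"
  shows "jacobi_sum R A B * cnj (jacobi_sum R A B)
           = of_nat (order R) - char_sum A - char_sum (\<lambda>x. A x * B x)"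
proof -
  let ?U = "carrier R - {\<zero>}"
  have fin: "finite ?U" using finite_carrier by simp
  have drop0: "sum f ?U = sum f (carrier R)" if "f \<zero> = 0" for f :: "_ \<Rightarrow> complex"
    using that by (intro sum.mono_neutral_left) (auto simp: finite_carrier)
  \<comment> \<open>The term at zero vanishes with \<open>A\<close>. Only units remain, so that
    \<open>x\<close> can be divided by \<open>y\<close> below.\<close>
  have J: "jacobi_sum R A B = (\<Sum>x\<in>?U. A x * B (\<one> \<ominus> x))"
    unfolding jacobi_sum_def using mult_charD(1)[OF A] by (intro drop0[symmetric]) auto
  have "jacobi_sum R A B * cnj (jacobi_sum R A B)
      = (\<Sum>y\<in>?U. \<Sum>x\<in>?U. A x * B (\<one> \<ominus> x) * cnj (A y * B (\<one> \<ominus> y)))"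
    unfolding J cnj_sum sum_product by (rule sum.swap)
  also have "\<dots> = (\<Sum>y\<in>?U. \<Sum>u\<in>?U. A (u \<otimes> y) * B (\<one> \<ominus> u \<otimes> y) * cnj (A y * B (\<one> \<ominus> y)))"
    by (intro sum.cong refl sum.reindex_bij_betw[OF mult_unit_bij_units, symmetric]) auto
  also have "\<dots> = (\<Sum>y\<in>?U. \<Sum>u\<in>?U. A u * (B (\<one> \<ominus> u \<otimes> y) * cnj (B (\<one> \<ominus> y))))"
  proof (intro sum.cong refl)
    fix u y assume uy: "u \<in> ?U" "y \<in> ?U"
    then have "A (u \<otimes> y) * cnj (A y) = A u * (A y * inverse (A y))"
      by (simp only: DiffD1 mult_char_mult[OF A] cnj_mult_char[OF A] mult.assoc)
    then have "A (u \<otimes> y) * cnj (A y) = A u"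
      using mult_charD(2)[OF A uy(2)] by simp
    moreover have "A (u \<otimes> y) * B (\<one> \<ominus> u \<otimes> y) * cnj (A y * B (\<one> \<ominus> y))
        = (A (u \<otimes> y) * cnj (A y)) * (B (\<one> \<ominus> u \<otimes> y) * cnj (B (\<one> \<ominus> y)))"
      by (simp only: complex_cnj_mult mult_ac)
    ultimately show "A (u \<otimes> y) * B (\<one> \<ominus> u \<otimes> y) * cnj (A y * B (\<one> \<ominus> y))
        = A u * (B (\<one> \<ominus> u \<otimes> y) * cnj (B (\<one> \<ominus> y)))"
      by (simp only:)
  qed
  also have "\<dots> = (\<Sum>u\<in>?U. A u * (\<Sum>y\<in>?U. B (\<one> \<ominus> u \<otimes> y) * cnj (B (\<one> \<ominus> y))))"
    by (subst sum.swap) (simp add: sum_distrib_left)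
  \<comment> \<open>The \<open>- 1\<close> removes the term \<open>y = \<zero>\<close>, equal to
    \<open>B \<one> * cnj (B \<one>) = 1\<close>, which the correlation over the whole field
    includes. It later produces \<open>- char_sum A\<close>.\<close>
  also have "\<dots> = (\<Sum>u\<in>?U. A u * ((if u = \<one> then of_nat (order R) else 0) - B u - 1))"
  proof (intro sum.cong refl)
    fix u assume u: "u \<in> ?U"
    have "\<one> \<ominus> \<zero> = \<one>" by algebra
    then have "(\<Sum>y\<in>carrier R. B (\<one> \<ominus> u \<otimes> y) * cnj (B (\<one> \<ominus> y)))
        = 1 + (\<Sum>y\<in>?U. B (\<one> \<ominus> u \<otimes> y) * cnj (B (\<one> \<ominus> y)))"
      using u mult_char_one[OF B] by (subst sum.remove[of _ \<zero>]) (auto simp: finite_carrier)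
    then have "(\<Sum>y\<in>?U. B (\<one> \<ominus> u \<otimes> y) * cnj (B (\<one> \<ominus> y)))
        = (\<Sum>y\<in>carrier R. B (\<one> \<ominus> u \<otimes> y) * cnj (B (\<one> \<ominus> y))) - 1"
      by (simp only: add_diff_cancel_left')
    also have "(\<Sum>y\<in>carrier R. B (\<one> \<ominus> u \<otimes> y) * cnj (B (\<one> \<ominus> y)))
        = (if u = \<one> then of_nat (order R) else 0) - B u"
      using u by (intro char_correlation[OF B B0]) auto
    finally show "A u * (\<Sum>y\<in>?U. B (\<one> \<ominus> u \<otimes> y) * cnj (B (\<one> \<ominus> y)))
        = A u * ((if u = \<one> then of_nat (order R) else 0) - B u - 1)"
      by (simp only:)
  qed
  also have "\<dots> = (\<Sum>u\<in>?U. (if u = \<one> then of_nat (order R) * A u else 0) - A u * B u - A u)"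
    by (intro sum.cong refl) (auto simp: right_diff_distrib)
  also have "\<dots> = of_nat (order R) - (\<Sum>u\<in>?U. A u * B u) - sum A ?U"
  proof -
    have "(\<Sum>u\<in>?U. if u = \<one> then of_nat (order R) * A u else 0) = of_nat (order R)"
      using mult_char_one[OF A] by (subst sum.delta[OF fin]) simp
    then show ?thesis
      by (simp only: sum_subtractf)
  qed
  also have "\<dots> = of_nat (order R) - char_sum A - char_sum (\<lambda>x. A x * B x)"
    using drop0[of A] drop0[of "\<lambda>u. A u * B u"] mult_charD(1)[OF A] by simp
  finally show ?thesis .
qed

text \<open>In the formula for the squared modulus, \<open>order R\<close> is diminished by two
  character sums with nonnegative real part. If instead \<open>A\<close> is the character with sum
  0, exchange the arguments.\<close>

lemma norm_jacobi_sum_le: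
  assumes A: "A \<in> mult_chars R" and B: "B \<in> mult_chars R"
    and nontrivial: "char_sum A = 0 \<or> char_sum B = 0"
  shows "cmod (jacobi_sum R A B) \<le> sqrt (order R)"
proof -
  have *: "cmod (jacobi_sum R A B) \<le> sqrt (order R)"
    if A: "A \<in> mult_chars R" and B: "B \<in> mult_chars R" and B0: "char_sum B = 0" for A B
  proof (rule real_le_rsqrt)
    have "(cmod (jacobi_sum R A B))\<^sup>2 = Re (jacobi_sum R A B * cnj (jacobi_sum R A B))"
      by (simp add: complex_norm_square[symmetric] del: of_real_power)
    also have "\<dots> \<le> order R"
      using char_sum_nonneg[OF A] char_sum_nonneg[OF mult_chars_closed_mult[OF A B]]
      by (simp add: jacobi_sum_mult_cnj[OF A B B0])
    finally show "(cmod (jacobi_sum R A B))\<^sup>2 \<le> order R" .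
  qed
  show ?thesis
    using nontrivial *[OF A B] *[OF B A] by (auto simp: jacobi_sum_commute[of A B])
qed

section \<open>The number of characters and the quadratic character\<close>

lemma unit_generator:
  obtains g where "g \<in> carrier R - {\<zero>}" "\<And>x. x \<in> carrier R - {\<zero>} \<Longrightarrow> \<exists>i::nat. x = g [^] i"
proof -
  obtain g where g: "g \<in> carrier (mult_of R)"
      "carrier (mult_of R) = {g [^] i | i::nat. i \<in> UNIV}"
    using finite_field_mult_group_has_gen[OF finite_carrier] by blast
  have "\<exists>i::nat. x = g [^] i" if "x \<in> carrier R - {\<zero>}" for x
    using g(2) that by auto
  with g(1) show thesis by (intro that) auto
qed

text \<open>A character is determined by its value at a generator of the cyclic unit group, and this
  value is a root of unity of order dividing \<open>order R - 1\<close>.\<close>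

lemma card_mult_chars_le: "card (mult_chars R) \<le> order R - 1"
proof -
  obtain g where g: "g \<in> carrier R - {\<zero>}"
      "\<And>x. x \<in> carrier R - {\<zero>} \<Longrightarrow> \<exists>i::nat. x = g [^] i"
    using unit_generator by blast
  have pos: "order R - 1 > 0" using order_ge_2 by simp
  have "inj_on (\<lambda>C. C g) (mult_chars R)"
  proof (intro inj_onI ext)
    fix C D x
    assume CD: "C \<in> mult_chars R" "D \<in> mult_chars R" "C g = D g"
    show "C x = D x"
    proof (cases "x \<in> carrier R - {\<zero>}")
      case True
      then obtain i :: nat where "x = g [^] i" using g(2) by blast
      then show ?thesis
        using CD g(1) by (simp add: mult_char_pow)
    next
      \<comment> \<open>Off the units both characters are 0 by the convention built into
        \<open>mult_chars\<close>; without it evaluation at \<open>g\<close> would not be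
        injective.\<close>
      case False
      then show ?thesis using CD(1,2) by (auto simp: mult_chars_def)
    qed
  qed
  moreover have "(\<lambda>C. C g) ` mult_chars R \<subseteq> {z. z ^ (order R - 1) = 1}"
    using g(1) unit_pow_eq_one[OF g(1)]
    by (auto simp: mult_char_pow[symmetric] mult_char_one)
  ultimately have "card (mult_chars R) \<le> card {z::complex. z ^ (order R - 1) = 1}"
    using card_inj_on_le finite_roots_unity pos by (metis One_nat_def Suc_leI)
  then show ?thesis
    using card_roots_unity_eq[OF pos] by simp
qed

text \<open>Multiplicativity says that a product of units is a square exactly when both or neither
  of the factors are. The case of two nonsquares uses a generator.\<close>

lemma quad_char_mult_char: "quad_char R \<in> mult_chars R"
proof (rule mult_charI)
  obtain g where g: "g \<in> carrier R - {\<zero>}"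
      "\<And>x. x \<in> carrier R - {\<zero>} \<Longrightarrow> \<exists>i::nat. x = g [^] i"
    using unit_generator by blast
  define sq where "sq x \<longleftrightarrow> (\<exists>y\<in>carrier R. x = y \<otimes> y)" for x
  have sq_mult: "sq (x \<otimes> y)" if "sq x" "sq y" for x y
  proof -
    from that obtain a b where ab: "a \<in> carrier R" "b \<in> carrier R" "x = a \<otimes> a" "y = b \<otimes> b"
      by (auto simp: sq_def)
    have "(a \<otimes> a) \<otimes> (b \<otimes> b) = (a \<otimes> b) \<otimes> (a \<otimes> b)"
      using ab(1,2) by algebra
    with ab show ?thesis unfolding sq_def by (intro bexI[of _ "a \<otimes> b"]) auto
  qed
  have sq_cancel: "sq y" if "sq x" "sq (x \<otimes> y)" and xy: "x \<in> carrier R - {\<zero>}" "y \<in> carrier R" for x y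
  proof -
    from that have xi: "inv x \<in> carrier R" "inv x \<otimes> x = \<one>"
      by (auto simp: field_Units)
    obtain a where a: "a \<in> carrier R" "x = a \<otimes> a"
      using \<open>sq x\<close> by (auto simp: sq_def)
    \<comment> \<open>From \<open>x = a \<otimes> a\<close> the inverse of \<open>x\<close> is the
      square of \<open>inv x \<otimes> a\<close>; multiplying by it cancels
      \<open>x\<close>.\<close>
    have "(inv x \<otimes> a) \<otimes> (inv x \<otimes> a) = inv x \<otimes> (inv x \<otimes> (a \<otimes> a))"
      using a(1) xi(1) by algebra
    also have "\<dots> = inv x \<otimes> (inv x \<otimes> x)" using a by simp
    also have "\<dots> = inv x" using xi by simp
    finally have "sq (inv x)"
      unfolding sq_def using a(1) xi(1) by (intro bexI[of _ "inv x \<otimes> a"]) auto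
    then have "sq (inv x \<otimes> (x \<otimes> y))"
      using that(2) by (rule sq_mult)
    moreover have "inv x \<otimes> (x \<otimes> y) = y"
      using xi xy m_assoc[of "inv x" x y] by simp
    ultimately show ?thesis by simp
  qed
  have sq_even: "sq (g [^] i)" if "even i" for i :: nat
  proof -
    from that obtain k where "i = k + k" by (metis evenE mult_2)
    then show ?thesis
      using g(1) unfolding sq_def by (intro bexI[of _ "g [^] k"]) (auto simp: nat_pow_mult)
  qed
  have sq_nonsq: "sq (x \<otimes> y)"
    if nsq: "\<not> sq x" "\<not> sq y" and xy: "x \<in> carrier R - {\<zero>}" "y \<in> carrier R - {\<zero>}" for x y
  proof -
    obtain i j :: nat where ij: "x = g [^] i" "y = g [^] j"
      using g(2) xy by meson
    \<comment> \<open>Even powers of \<open>g\<close> are squares, so both exponents are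
      odd.\<close>
    then have "even (i + j)" using sq_even nsq by auto
    from sq_even[OF this] show ?thesis
      using g(1) ij by (simp add: nat_pow_mult)
  qed
  fix x y assume xy: "x \<in> carrier R - {\<zero>}" "y \<in> carrier R - {\<zero>}"
  then have xy': "x \<otimes> y \<in> carrier R - {\<zero>}" by (auto simp: integral_iff)
  have qc: "quad_char R z = (if sq z then 1 else -1)" if "z \<in> carrier R - {\<zero>}" for z
    using that by (simp add: quad_char_def sq_def)
  have "sq (x \<otimes> y) \<longleftrightarrow> (sq x \<longleftrightarrow> sq y)"
    using sq_mult sq_cancel[of x y] sq_cancel[of y x] sq_nonsq xy m_comm[of x y] by auto
  then show "quad_char R (x \<otimes> y) = quad_char R x * quad_char R y"
    using xy xy' by (simp add: qc)
qed (auto simp: quad_char_def)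

text \<open>The distinct elements \<open>\<one>\<close> and \<open>\<ominus> \<one>\<close> have the
  same square, so squaring is not injective and, the field being finite, not surjective. A nonsquare
  makes the quadratic character nontrivial.\<close>

lemma char_sum_quad_char:
  assumes "\<one> \<noteq> \<ominus> \<one>"
  shows "char_sum (quad_char R) = 0"
proof -
  have "\<not> inj_on (\<lambda>y. y \<otimes> y) (carrier R)"
  proof
    assume inj: "inj_on (\<lambda>y. y \<otimes> y) (carrier R)"
    have "\<ominus> \<one> \<otimes> \<ominus> \<one> = \<one> \<otimes> \<one>" by algebra
    with inj have "\<ominus> \<one> = \<one>" by (rule inj_onD) auto
    with assms show False by simp
  qed
  then have "(\<lambda>y. y \<otimes> y) ` carrier R \<noteq> carrier R"
    using finite_carrier eq_card_imp_inj_on by metis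
  then obtain a where a: "a \<in> carrier R" "\<forall>y\<in>carrier R. a \<noteq> y \<otimes> y"
    by (auto simp: image_def set_eq_iff)
  then have "a \<noteq> \<zero>" by force
  with a have "quad_char R a = -1" by (auto simp: quad_char_def)
  then have "quad_char R a \<noteq> 1" by simp
  with char_sum_cases[OF quad_char_mult_char] a \<open>a \<noteq> \<zero>\<close> show ?thesis by blast
qed

section \<open>Bounds for the coefficients and the hypergeometric value\<close>

text \<open>If the inverse of \<open>C\<close> has nonzero sum, then \<open>C\<close> is trivial and
  the other character of the Jacobi sum is the quadratic one, whose sum is 0. Either way the Jacobi
  sum is at most the square root of \<open>order R\<close>, and the binomial divides it by
  \<open>order R\<close>.\<close>

lemma norm_char_binom_le:
  assumes "\<one> \<noteq> \<ominus> \<one>" and C: "C \<in> mult_chars R"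
  shows "cmod (char_binom R (\<lambda>y. quad_char R y * C y) C) \<le> 1 / sqrt (order R)"
proof -
  let ?A = "\<lambda>y. quad_char R y * C y" and ?B = "\<lambda>x. inverse (C x)"
  have A: "?A \<in> mult_chars R"
    using quad_char_mult_char C by (rule mult_chars_closed_mult)
  have B: "?B \<in> mult_chars R"
    using C by (rule mult_chars_closed_inverse)
  have "char_sum ?A = 0 \<or> char_sum ?B = 0"
  proof (rule disjCI)
    assume "char_sum ?B \<noteq> 0"
    then have "C x = 1" if "x \<in> carrier R - {\<zero>}" for x
      using char_sum_cases[OF B] that by force
    then have "char_sum ?A = char_sum (quad_char R)"
      using mult_charD(1)[OF quad_char_mult_char] by (intro sum.cong refl) force
    then show "char_sum ?A = 0"
      using char_sum_quad_char[OF assms(1)] by simp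
  qed
  then have J: "cmod (jacobi_sum R ?A ?B) \<le> sqrt (order R)"
    by (rule norm_jacobi_sum_le[OF A B])
  have "cmod (char_binom R ?A C)
      = cmod (C (\<ominus> \<one>)) * cmod (jacobi_sum R ?A ?B) / order R"
    by (simp add: char_binom_def norm_mult norm_divide)
  also have "\<dots> \<le> 1 * sqrt (order R) / order R"
    using J norm_mult_char_le[OF C, of "\<ominus> \<one>"] by (intro divide_right_mono mult_mono) auto
  also have "\<dots> = 1 / sqrt (order R)"
    using order_ge_2 by (simp add: field_simps)
  finally show ?thesis .
qed

text \<open>Triangle inequality with \<open>\<chi> \<one> = 1\<close>: the bound
  \<open>order R - 1\<close> on the number of characters cancels the denominator of the
  prefactor.\<close>

lemma norm_hyp_F_one_le:
  assumes "\<one> \<noteq> \<ominus> \<one>"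
  shows "cmod (hyp_F R n \<one>) \<le> order R * (1 / sqrt (order R)) ^ (n + 1)"
proof -
  let ?q = "real (order R)" and ?S = "\<Sum>\<chi>\<in>mult_chars R.
      char_binom R (\<lambda>y. quad_char R y * \<chi> y) \<chi> ^ (n + 1) * \<chi> \<one>"
  have q: "?q \<ge> 2" using order_ge_2 by simp
  have "cmod ?S \<le> (\<Sum>\<chi>\<in>mult_chars R. (1 / sqrt ?q) ^ (n + 1))"
    by (intro sum_norm_le)
       (use norm_char_binom_le[OF assms] in
          \<open>auto simp: mult_char_one norm_power norm_mult simp del: power_Suc intro!: power_mono\<close>)
  also have "\<dots> \<le> (?q - 1) * (1 / sqrt ?q) ^ (n + 1)"
    using card_mult_chars_le q unfolding sum_constant
    by (intro mult_right_mono) (auto simp: of_nat_diff)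
  finally have S: "cmod ?S \<le> (?q - 1) * (1 / sqrt ?q) ^ (n + 1)" .
  have "cmod (of_nat (order R) - 1) = ?q - 1"
    using q by (metis abs_of_nonneg diff_ge_0_iff_ge norm_of_real of_real_1 of_real_diff
        of_real_of_nat_eq one_le_numeral order_trans)
  then have "cmod (hyp_F R n \<one>) = ?q / (?q - 1) * cmod ?S"
    unfolding hyp_F_def by (simp only: norm_mult norm_divide norm_of_nat)
  also have "\<dots> \<le> ?q / (?q - 1) * ((?q - 1) * (1 / sqrt ?q) ^ (n + 1))"
    using S q by (intro mult_left_mono) auto
  also have "\<dots> = ?q * (1 / sqrt ?q) ^ (n + 1)"
    using q by simp
  finally show ?thesis .
qed

end

section \<open>Prime fields and asymptotics\<close>

text \<open>The index \<open>2 * m + 1\<close> makes the exponent of the coefficients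
  \<open>2 * (m + 1)\<close>, so the square roots disappear and one factor \<open>q\<close> of
  \<open>q ^ (m + 1)\<close> is absorbed by the prefactor.\<close>

lemma norm_hyp_F_residue_ring_le:
  assumes "prime q" "odd q"
  shows "cmod (hyp_F (residue_ring (int q)) (2 * m + 1) \<one>\<^bsub>residue_ring (int q)\<^esub>) \<le> 1 / real q ^ m"
proof -
  let ?R = "residue_ring (int q)"
  interpret residues_prime q ?R
    by unfold_locales (use assms in auto)
  interpret finite_field ?R
    by (intro finite_field.intro is_field finite_field_axioms.intro finite)
  have q: "q > 2" using assms prime_gt_1_nat[of q] by (cases "q = 2") auto
  have ord: "order ?R = q"
    using res_carrier_eq q by (simp add: order_def)
  \<comment> \<open>The negative of one is represented by \<open>q - 1\<close>, which differs from 1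
    because \<open>q > 2\<close>.\<close>
  have "\<one>\<^bsub>?R\<^esub> \<noteq> \<ominus>\<^bsub>?R\<^esub> \<one>\<^bsub>?R\<^esub>"
    using q by (simp add: res_one_eq res_neg_eq zmod_zminus1_eq_if)
  moreover have "2 * m + 1 + 1 = 2 * (m + 1)" by simp
  ultimately have "cmod (hyp_F ?R (2 * m + 1) \<one>\<^bsub>?R\<^esub>) \<le> q * ((1 / sqrt q)\<^sup>2) ^ (m + 1)"
    using norm_hyp_F_one_le[of "2 * m + 1"] unfolding ord by (metis power_mult)
  also have "\<dots> = 1 / real q ^ m"
    using q by (simp add: power_divide)
  finally show ?thesis .
qed

lemma eventually_odd_primes_at_top: "eventually (\<lambda>q. prime q \<and> odd q) odd_primes_at_top"
  by (simp add: odd_primes_at_top_def eventually_inf_principal)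

theorem corollary4p6:
  "(\<exists>E :: nat \<Rightarrow> real.
      E \<in> O[odd_primes_at_top](\<lambda>q. 1 / real q powr (3 / 2)) \<and>
      (\<forall>q. prime q \<and> odd q \<longrightarrow>
         cmod (hyp_F (residue_ring (int q)) 3 \<one>\<^bsub>residue_ring (int q)\<^esub> - 1 / of_nat q ^ 3)
           \<le> 1 / real q + E q))
   \<and> (\<lambda>q. cmod (hyp_F (residue_ring (int q)) 5 \<one>\<^bsub>residue_ring (int q)\<^esub>))
        \<in> O[odd_primes_at_top](\<lambda>q. 1 / real q ^ 2)"
proof (intro conjI exI allI impI)
  \<comment> \<open>The error term is \<open>E q = 1 / q ^ 3\<close>, the cost of subtracting the
    main term by the triangle inequality; it is smaller than the error allowed.\<close>
  show "(\<lambda>q. 1 / real q ^ 3) \<in> O[odd_primes_at_top](\<lambda>q. 1 / real q powr (3 / 2))"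
  proof (rule bigoI[where c = 1])
    show "\<forall>\<^sub>F q in odd_primes_at_top. norm (1 / real q ^ 3) \<le> 1 * norm (1 / real q powr (3 / 2))"
      using eventually_odd_primes_at_top
    proof eventually_elim
      case (elim q)
      then have "real q \<ge> 1" using prime_ge_1_nat[of q] by simp
      moreover from this have "real q powr (3 / 2) \<le> real q powr 3"
        by (intro powr_mono) auto
      ultimately show ?case
        by (simp add: powr_numeral frac_le)
    qed
  qed
next
  fix q :: nat assume q: "prime q \<and> odd q"
  have "cmod (hyp_F (residue_ring (int q)) 3 \<one>\<^bsub>residue_ring (int q)\<^esub>) \<le> 1 / real q"
    using norm_hyp_F_residue_ring_le[of q 1] q by simp
  moreover have "cmod (1 / of_nat q ^ 3) = 1 / real q ^ 3"
    by (simp add: norm_divide norm_power)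
  ultimately show "cmod (hyp_F (residue_ring (int q)) 3 \<one>\<^bsub>residue_ring (int q)\<^esub> - 1 / of_nat q ^ 3)
      \<le> 1 / real q + 1 / real q ^ 3"
    by (smt (verit) norm_triangle_ineq4)
next
  show "(\<lambda>q. cmod (hyp_F (residue_ring (int q)) 5 \<one>\<^bsub>residue_ring (int q)\<^esub>))
      \<in> O[odd_primes_at_top](\<lambda>q. 1 / real q ^ 2)"
  proof (rule bigoI[where c = 1])
    show "\<forall>\<^sub>F q in odd_primes_at_top.
        norm (cmod (hyp_F (residue_ring (int q)) 5 \<one>\<^bsub>residue_ring (int q)\<^esub>))
          \<le> 1 * norm (1 / real q ^ 2)"
      using eventually_odd_primes_at_top
    proof eventually_elim
      case (elim q)
      \<comment> \<open>Here \<open>m = 2\<close>, since \<open>5 = 2 * 2 + 1\<close>.\<close>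
      then show ?case using norm_hyp_F_residue_ring_le[of q 2] by simp
    qed
  qed
qed

end
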